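(* Let $G=(V,E)$ be a finite, simple, undirected, connected graph with a non-empty boundary vertex set $B\subseteq V$. Then the following properties hold for generic weights, i.e. for each of them the set of $w\in\mathbb{R}_{+}^{|E|}$ such that $(G,B,w)$ does not have the property has Lebesgue measure zero in $\mathbb{R}_{+}^{|E|}$: (1) the eigenspaces of the Steklov eigenvalues of $(G,B,w)$ are one-dimensional, i.e. all Steklov eigenvalues are simple; (2) every Steklov eigenfunction $f\in\mathbb{R}^B$ of $(G,B,w)$ does not vanish on $B$, i.e. $f(x)\neq 0$ for every $x\in B$.
   Context: $\mathbb{R}_{+}$ denotes the set of positive real numbers. A weight is a function $w:E\to\mathbb{R}_{+}$, identified with a point of $\mathbb{R}_{+}^{|E|}$; $w(x,y)$ is the weight of the edge $\{x,y\}$. Put $B^c=V\setminus B$. For $u\in\mathbb{R}^V$ and $x\in V$ set $(\Delta u)(x)=\sum_{y:\{x,y\}\in E}w(x,y)(u(x)-u(y))$, and for $x\in B$ set $(\partial_\nu u)(x)=\sum_{y:\{x,y\}\in E}w(x,y)(u(x)-u(y))$. For $f\in\mathbb{R}^B$, the harmonic extension $h_f\in\mathbb{R}^V$ is the unique function with $h_f|_B=f$ and $(\Delta h_f)(x)=0$ for all $x\in B^c$ (it exists and is unique since $G$ is connected and $B\neq\emptyset$). The Steklov operator (Dirichlet-to-Neumann map) of $(G,B,w)$ is the linear map $\Lambda:\mathbb{R}^B\to\mathbb{R}^B$, $f\mapsto\partial_\nu h_f$. Its eigenvalues are the Steklov eigenvalues and its (nonzero) eigenfunctions $f\in\mathbb{R}^B$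 are the Steklov eigenfunctions of $(G,B,w)$. *)

theory Defs
  imports "HOL-Analysis.Analysis"
begin

text \<open>
  The vertex set is the finite type \<open>'v\<close>; an edge is a set of two vertices.
  Thus \<open>\<real>\<^sup>V\<close> is \<^typ>\<open>real ^ 'v\<close>, and \<open>\<real>\<^sup>B\<close> is identified with its subspace of
  vectors vanishing off \<open>B\<close>.
\<close>

definition simple_graph :: "'v set set \<Rightarrow> bool" where
  "simple_graph E \<longleftrightarrow> (\<forall>e\<in>E. card e = 2)"

definition connected_graph :: "'v set set \<Rightarrow> bool" where
  "connected_graph E \<longleftrightarrow> (\<forall>x y. (x, y) \<in> {(a, b). {a, b} \<in> E}\<^sup>*)"

definition boundary_space :: "'v::finite set \<Rightarrow> (real ^ 'v) set" where
  "boundary_space B = {f. \<forall>x. x \<notin> B \<longrightarrow> f $ x = 0}"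

definition positive_weights :: "'v set set \<Rightarrow> ('v set \<Rightarrow> real) set" where
  "positive_weights E = (E \<rightarrow>\<^sub>E {0<..})"

text \<open>
  The product of \<^const>\<open>lborel\<close> over \<open>E\<close> is only the Borel-Lebesgue measure on \<open>\<real>\<^sup>E\<close>;
  its completion is Lebesgue measure. The exceptional set is not assumed to be Borel.
\<close>

definition generic_weights :: "'v::finite set set \<Rightarrow> (('v set \<Rightarrow> real) \<Rightarrow> bool) \<Rightarrow> bool" where
  "generic_weights E P \<longleftrightarrow>
     {w \<in> positive_weights E. \<not> P w} \<in> null_sets (completion (\<Pi>\<^sub>M e\<in>E. lborel))"

definition graph_laplacian ::
  "'v::finite set set \<Rightarrow> ('v set \<Rightarrow> real) \<Rightarrow> real ^ 'v \<Rightarrow> real ^ 'v" where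
  "graph_laplacian E w u = (\<chi> x. \<Sum>y | {x, y} \<in> E. w {x, y} * (u $ x - u $ y))"

definition normal_derivative ::
  "'v::finite set set \<Rightarrow> 'v set \<Rightarrow> ('v set \<Rightarrow> real) \<Rightarrow> real ^ 'v \<Rightarrow> real ^ 'v" where
  "normal_derivative E B w u =
     (\<chi> x. if x \<in> B then \<Sum>y | {x, y} \<in> E. w {x, y} * (u $ x - u $ y) else 0)"

definition harmonic_extension ::
  "'v::finite set set \<Rightarrow> 'v set \<Rightarrow> ('v set \<Rightarrow> real) \<Rightarrow> real ^ 'v \<Rightarrow> real ^ 'v" where
  "harmonic_extension E B w f =
     (THE h. (\<forall>x\<in>B. h $ x = f $ x) \<and> (\<forall>x\<in>-B. graph_laplacian E w h $ x = 0))"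

definition steklov_operator ::
  "'v::finite set set \<Rightarrow> 'v set \<Rightarrow> ('v set \<Rightarrow> real) \<Rightarrow> real ^ 'v \<Rightarrow> real ^ 'v" where
  "steklov_operator E B w f = normal_derivative E B w (harmonic_extension E B w f)"

definition steklov_eigenspace ::
  "'v::finite set set \<Rightarrow> 'v set \<Rightarrow> ('v set \<Rightarrow> real) \<Rightarrow> real \<Rightarrow> (real ^ 'v) set" where
  "steklov_eigenspace E B w \<mu> = {f \<in> boundary_space B. steklov_operator E B w f = \<mu> *\<^sub>R f}"

definition steklov_eigenvalue ::
  "'v::finite set set \<Rightarrow> 'v set \<Rightarrow> ('v set \<Rightarrow> real) \<Rightarrow> real \<Rightarrow> bool" where
  "steklov_eigenvalue E B w \<mu> \<longleftrightarrow> (\<exists>f \<in> steklov_eigenspace E B w \<mu>. f \<noteq> 0)"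

definition steklov_eigenfunction ::
  "'v::finite set set \<Rightarrow> 'v set \<Rightarrow> ('v set \<Rightarrow> real) \<Rightarrow> real ^ 'v \<Rightarrow> bool" where
  "steklov_eigenfunction E B w f \<longleftrightarrow> f \<noteq> 0 \<and> (\<exists>\<mu>. f \<in> steklov_eigenspace E B w \<mu>)"

text \<open>The description in \<^const>\<open>harmonic_extension\<close> is proper.\<close>

lemma harmonic_nonpos:
  fixes h :: "real ^ 'v::finite"
  assumes con: "connected_graph E" and ne: "B \<noteq> {}" and w: "w \<in> positive_weights E"
    and B: "\<forall>x\<in>B. h $ x = 0" and harm: "\<forall>x\<in>-B. graph_laplacian E w h $ x = 0"
  shows "h $ z \<le> 0"
proof -
  define M where "M = Max (range (($) h))"
  have le: "h $ y \<le> M" for y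
    unfolding M_def by (rule Max_ge) auto
  have "M \<in> range (($) h)"
    unfolding M_def by (rule Max_in) auto
  then obtain x where x: "h $ x = M" by auto
  obtain b where b: "b \<in> B" using ne by auto
  have "(x, b) \<in> {(a, b). {a, b} \<in> E}\<^sup>*"
    using con by (simp add: connected_graph_def)
  then have "h $ b = M \<or> (\<exists>c\<in>B. h $ c = M)"
  proof (induction rule: rtrancl_induct)
    case base
    then show ?case using x by simp
  next
    case (step y z)
    show ?case
    proof (cases "\<exists>c\<in>B. h $ c = M")
      case False
      then have y: "h $ y = M" "y \<notin> B" using step by auto
      then have "(\<Sum>v | {y, v} \<in> E. w {y, v} * (h $ y - h $ v)) = 0"
        using harm by (auto simp: graph_laplacian_def)
      moreover have pos: "0 < w {y, v}" if "{y, v} \<in> E" for v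
        using w that by (auto simp: positive_weights_def dest: PiE_mem)
      ultimately have "\<forall>v\<in>{v. {y, v} \<in> E}. w {y, v} * (h $ y - h $ v) = 0"
        by (subst (asm) sum_nonneg_eq_0_iff) (auto simp: y le less_imp_le)
      then show ?thesis using step.hyps(2) pos[of z] y by force
    qed blast
  qed
  then have "M = 0" using B b by force
  then show ?thesis using le by simp
qed

lemma harmonic_extension_ex1:
  fixes f :: "real ^ 'v::finite"
  assumes "connected_graph E" "B \<noteq> {}" "w \<in> positive_weights E"
  shows "\<exists>!h. (\<forall>x\<in>B. h $ x = f $ x) \<and> (\<forall>x\<in>-B. graph_laplacian E w h $ x = 0)"
proof -
  define T where "T h = (\<chi> x. if x \<in> B then h $ x else graph_laplacian E w h $ x)"
    for h :: "real ^ 'v"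
  have lin: "linear T"
  proof (rule linearI)
    show "T (u + v) = T u + T v" for u v
      by (simp add: T_def graph_laplacian_def vec_eq_iff distrib_left right_diff_distrib
          sum.distrib sum_subtractf)
    show "T (c *\<^sub>R u) = c *\<^sub>R T u" for c u
      by (simp add: T_def graph_laplacian_def vec_eq_iff right_diff_distrib
          sum_subtractf sum_distrib_left mult.left_commute)
  qed
  have "h = 0" if "T h = 0" for h
  proof -
    have *: "\<forall>x\<in>B. h $ x = 0" "\<forall>x\<in>-B. graph_laplacian E w h $ x = 0"
      using that by (auto simp: T_def vec_eq_iff split: if_splits)
    have "graph_laplacian E w (- h) $ x = - (graph_laplacian E w h $ x)" for x
      by (simp add: graph_laplacian_def sum_negf[symmetric] algebra_simps)
    then have "\<forall>x\<in>-B. graph_laplacian E w (- h) $ x = 0" using *(2) by simp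
    then have "(- h) $ z \<le> 0" for z
      using harmonic_nonpos[OF assms, of "- h"] *(1) by simp
    moreover have "h $ z \<le> 0" for z
      using harmonic_nonpos[OF assms *] .
    ultimately show ?thesis by (simp add: vec_eq_iff order_antisym)
  qed
  then have "inj T" using lin linear_injective_0 by blast
  then have "bij T" using lin linear_injective_imp_surjective by (blast intro: bijI)
  then have "\<exists>!h. T h = (\<chi> x. if x \<in> B then f $ x else 0)"
    by (simp add: bij_iff)
  moreover have "T h = (\<chi> x. if x \<in> B then f $ x else 0) \<longleftrightarrow>
      (\<forall>x\<in>B. h $ x = f $ x) \<and> (\<forall>x\<in>-B. graph_laplacian E w h $ x = 0)" for h
    by (auto simp: T_def vec_eq_iff)
  ultimately show ?thesis by simp
qed

end

theory Submission
  imports Defs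
begin

text \<open>
  If no Steklov eigenfunction vanishes at some fixed \<open>x \<in> B\<close>, then all eigenvalues are simple,
  since in a two-dimensional eigenspace some nonzero function vanishes at \<open>x\<close>. So only the second
  property is needed.

  As the Steklov operator \<open>\<Lambda>\<close> is self-adjoint, it has no eigenfunction vanishing at \<open>x\<close> exactly
  when the indicator of \<open>x\<close> is a cyclic vector. After clearing the denominator of \<open>\<Lambda>\<close> by Cramer's
  rule, a determinant of Krylov vectors witnesses this; it is polynomial in the weights, so its
  zeros form a null set unless it vanishes identically. A single weight with a nonzero determinant
  therefore suffices, and it may vanish on some edges. It is built on a spanning tree rooted at
  \<open>x\<close>, by hanging rooted trees from one another and rescaling the hung tree so that the Dirichlet
  spectra of the two parts are disjoint.
\<close>

section \<open>Zeros of polynomials\<close>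

text \<open>Polynomials are taken as functions of the weights rather than as formal objects. The
  index set \<open>I\<close> records which coordinates may occur, so an induction over the variables
  is possible.\<close>

inductive poly_on :: "'i set \<Rightarrow> (('i \<Rightarrow> real) \<Rightarrow> real) \<Rightarrow> bool" for I where
  coord: "i \<in> I \<Longrightarrow> poly_on I (\<lambda>w. w i)"
| const: "poly_on I (\<lambda>w. c)"
| add: "poly_on I p \<Longrightarrow> poly_on I q \<Longrightarrow> poly_on I (\<lambda>w. p w + q w)"
| mult: "poly_on I p \<Longrightarrow> poly_on I q \<Longrightarrow> poly_on I (\<lambda>w. p w * q w)"

lemma poly_on_diff:
  assumes "poly_on I p" "poly_on I q"
  shows "poly_on I (\<lambda>w. p w - q w)"
  using poly_on.add[OF assms(1) poly_on.mult[OF poly_on.const[of I "-1"] assms(2)]] by simp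

lemma poly_on_if:
  "(c \<Longrightarrow> poly_on I p) \<Longrightarrow> (\<not> c \<Longrightarrow> poly_on I q) \<Longrightarrow> poly_on I (\<lambda>w. if c then p w else q w)"
  by (cases c) auto

lemma poly_on_sum:
  "(\<And>a. a \<in> A \<Longrightarrow> poly_on I (p a)) \<Longrightarrow> poly_on I (\<lambda>w. \<Sum>a\<in>A. p a w)"
  by (induction A rule: infinite_finite_induct) (auto intro: poly_on.intros)

lemma poly_on_prod:
  "(\<And>a. a \<in> A \<Longrightarrow> poly_on I (p a)) \<Longrightarrow> poly_on I (\<lambda>w. \<Prod>a\<in>A. p a w)"
  by (induction A rule: infinite_finite_induct) (auto intro: poly_on.intros)

lemma poly_on_det:
  fixes A :: "('i \<Rightarrow> real) \<Rightarrow> real ^ 'n ^ 'n"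
  assumes "\<And>i j. poly_on I (\<lambda>w. A w $ i $ j)"
  shows "poly_on I (\<lambda>w. det (A w))"
  unfolding det_def by (intro poly_on_sum poly_on_prod poly_on.mult poly_on.const assms)

lemma poly_on_cong:
  "poly_on I p \<Longrightarrow> (\<And>i. i \<in> I \<Longrightarrow> v i = w i) \<Longrightarrow> p v = p w"
  by (induction rule: poly_on.induct) auto

text \<open>Freezing a coordinate eliminates one variable, which drives the induction in
  \<open>poly_on_zeros_null\<close>.\<close>

lemma poly_on_subst:
  "poly_on (insert i I) p \<Longrightarrow> poly_on I (\<lambda>w. p (w(i := t)))"
proof (induction rule: poly_on.induct)
  case (coord j)
  then show ?case by (cases "j = i") (auto intro: poly_on.intros)
qed (auto intro: poly_on.intros)

lemma poly_on_measurable: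
  "poly_on I p \<Longrightarrow> p \<in> borel_measurable (\<Pi>\<^sub>M i\<in>I. lborel)"
proof (induction rule: poly_on.induct)
  case (coord i)
  then have "(\<lambda>w. w i) \<in> measurable (\<Pi>\<^sub>M i\<in>I. lborel) lborel"
    by (rule measurable_component_singleton)
  then show ?case by simp
qed auto

lemma poly_on_section:
  "poly_on I p \<Longrightarrow> real_polynomial_function (\<lambda>t. p (w(i := t)))"
proof (induction rule: poly_on.induct)
  case (coord j)
  then show ?case by (cases "j = i") (auto intro: bounded_linear_ident)
qed auto

lemma real_polynomial_function_finite_zeros:
  fixes p :: "real \<Rightarrow> real"
  assumes "real_polynomial_function p" "p a \<noteq> 0"
  shows "finite {t. p t = 0}"
proof -
  obtain c n where p: "p = (\<lambda>t. \<Sum>i\<le>n. c i * t ^ i)"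
    using assms(1) by (auto simp: real_polynomial_function_iff_sum)
  have "\<exists>i\<le>n. c i \<noteq> 0"
    using assms(2) by (rule contrapos_np) (auto simp: p)
  then show ?thesis
    unfolding p using polyfun_finite_roots by blast
qed

text \<open>Induction on the number of variables with Tonelli: for almost all values of the other
  variables the section in the new variable is a nonzero polynomial, hence has finitely many
  zeros.\<close>

lemma poly_on_zeros_null:
  fixes v :: "'i \<Rightarrow> real"
  assumes "finite I" "poly_on I p" "p v \<noteq> 0"
  shows "{w \<in> space (\<Pi>\<^sub>M i\<in>I. lborel). p w = 0} \<in> null_sets (\<Pi>\<^sub>M i\<in>I. lborel)"
  using assms
proof (induction I arbitrary: p rule: finite_induct)
  case empty
  then have "p w \<noteq> 0" for w
    \<comment> \<open>Without variables a polynomial is constant, so its value at \<open>v\<close>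
      is its value everywhere.\<close>
    using poly_on_cong[of "{}" p w v] by simp
  then show ?case by simp
next
  case (insert i I)
  interpret product_sigma_finite "\<lambda>_ :: 'i. lborel :: real measure" ..
  let ?M = "\<lambda>J. \<Pi>\<^sub>M j\<in>J. (lborel :: real measure)"
  define Z where "Z = {w \<in> space (?M (insert i I)). p w = 0}"
  note [measurable] = poly_on_measurable[OF insert.prems(1)]
  have Z: "Z \<in> sets (?M (insert i I))"
    unfolding Z_def by measurable
  \<comment> \<open>Freezing coordinate \<open>i\<close> at \<open>v i\<close> keeps
    \<open>v\<close> as a point where the smaller polynomial is nonzero.\<close>
  have "{w \<in> space (?M I). p (w(i := v i)) = 0} \<in> null_sets (?M I)"
    using insert.prems by (intro insert.IH poly_on_subst) auto
  then have ae: "AE w in ?M I. p (w(i := v i)) \<noteq> 0"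
    by (rule AE_I') auto
  have "emeasure (?M (insert i I)) Z = (\<integral>\<^sup>+ w. indicator Z w \<partial>?M (insert i I))"
    using Z by simp
  also have "\<dots> = (\<integral>\<^sup>+ w. (\<integral>\<^sup>+ t. indicator Z (w(i := t)) \<partial>lborel) \<partial>?M I)"
    using insert.hyps Z by (intro product_nn_integral_insert) auto
  also have "\<dots> = (\<integral>\<^sup>+ w. 0 \<partial>?M I)"
  proof (rule nn_integral_cong_AE, use ae in eventually_elim)
    fix w assume "p (w(i := v i)) \<noteq> 0"
    then have "finite {t. p (w(i := t)) = 0}"
      by (rule real_polynomial_function_finite_zeros[OF poly_on_section[OF insert.prems(1)]])
    then have "{t. p (w(i := t)) = 0} \<in> null_sets lborel"
      by (rule finite_imp_null_set_lborel)
    then have "AE t in lborel. p (w(i := t)) \<noteq> 0"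
      by (rule AE_I') auto
    then have "AE t in lborel. indicator Z (w(i := t)) = (0 :: ennreal)"
      by eventually_elim (auto simp: Z_def)
    then show "(\<integral>\<^sup>+ t. indicator Z (w(i := t)) \<partial>lborel) = 0"
      by (subst nn_integral_cong_AE[where v = "\<lambda>_. 0"]) auto
  qed
  finally show ?case
    using Z by (auto simp: Z_def)
qed

section \<open>Self-adjoint operators and the graph Laplacian\<close>

text \<open>The values \<nu> are zeros of \<open>det (F - \<nu> G)\<close>, a polynomial in \<nu>
  that is nonzero at 0 because \<open>F\<close> is injective.\<close>

lemma finite_pencil_spectrum:
  fixes F G :: "real ^ 'n \<Rightarrow> real ^ 'n"
  assumes "linear F" "linear G" and inj: "\<And>h. F h = 0 \<Longrightarrow> h = 0"
  shows "finite {\<nu>. \<exists>h. h \<noteq> 0 \<and> F h = \<nu> *\<^sub>R G h}"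
proof -
  define A where "A = (\<lambda>\<nu>. matrix F - \<nu> *\<^sub>R matrix G)"
  have A: "A \<nu> *v h = F h - \<nu> *\<^sub>R G h" for \<nu> h
    using assms by (simp add: A_def matrix_vector_mult_diff_rdistrib scaleR_matrix_vector_assoc[symmetric] matrix_works)
  \<comment> \<open>The single variable \<nu> is modelled as the only coordinate of a function on
    \<open>unit\<close>, so that \<open>poly_on_det\<close> applies.\<close>
  have poly: "poly_on UNIV (\<lambda>w :: unit \<Rightarrow> real. det (A (w ())))"
    by (intro poly_on_det) (auto simp: A_def intro!: poly_on_diff poly_on.intros)
  have "det (A 0) \<noteq> 0"
    using inj A[of 0] by (simp add: invertible_det_nz[symmetric] invertible_left_inverse
        matrix_left_invertible_ker)
  then have "finite {\<nu>. det (A \<nu>) = 0}"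
    using real_polynomial_function_finite_zeros[OF poly_on_section[OF poly, of undefined "()"], of 0]
    by simp
  moreover have "{\<nu>. \<exists>h. h \<noteq> 0 \<and> F h = \<nu> *\<^sub>R G h} \<subseteq> {\<nu>. det (A \<nu>) = 0}"
  proof safe
    fix \<nu> h assume "h \<noteq> 0" "F h = \<nu> *\<^sub>R G h"
    then have "\<not> invertible (A \<nu>)"
      using A[of \<nu> h] by (auto simp: invertible_left_inverse matrix_left_invertible_ker)
    then show "det (A \<nu>) = 0"
      by (simp add: invertible_det_nz)
  qed
  ultimately show ?thesis
    by (rule rev_finite_subset)
qed

text \<open>A maximiser \<open>f\<close> of the quadratic form on the unit sphere of
  \<open>U\<close> is an eigenvector: otherwise moving \<open>f\<close> along the residual
  \<open>M f - c f\<close> would increase the Rayleigh quotient.\<close>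

lemma self_adjoint_has_eigenvector:
  fixes M :: "'a::euclidean_space \<Rightarrow> 'a"
  assumes lin: "linear M" and U: "subspace U" and inv: "\<And>u. u \<in> U \<Longrightarrow> M u \<in> U"
    and sym: "\<And>u v. u \<in> U \<Longrightarrow> v \<in> U \<Longrightarrow> M u \<bullet> v = u \<bullet> M v"
    and g: "g \<in> U" "g \<noteq> 0"
  obtains f c where "f \<in> U" "f \<noteq> 0" "M f = c *\<^sub>R f"
proof -
  let ?S = "U \<inter> sphere 0 1"
  have "compact ?S"
    using closed_subspace[OF U] by (simp add: closed_Int_compact)
  moreover have "(1 / norm g) *\<^sub>R g \<in> ?S"
    using g by (simp add: U subspace_scale)
  moreover have "continuous_on ?S (\<lambda>u. M u \<bullet> u)"
    using lin by (intro continuous_intros linear_continuous_on linear_conv_bounded_linear[THEN iffD1])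
  ultimately obtain f where f: "f \<in> ?S" and max: "\<And>u. u \<in> ?S \<Longrightarrow> M u \<bullet> u \<le> M f \<bullet> f"
    using continuous_attains_sup[of ?S "\<lambda>u. M u \<bullet> u"] by blast
  define c where "c = M f \<bullet> f"
  have quad: "M u \<bullet> u \<le> c * (u \<bullet> u)" if u: "u \<in> U" for u
  proof (cases "u = 0")
    case False
    have "(1 / norm u) *\<^sub>R u \<in> ?S"
      using u False by (simp add: U subspace_scale)
    from max[OF this] have "(M u \<bullet> u) / (norm u)\<^sup>2 \<le> c"
      by (simp add: c_def linear_scale[OF lin] power2_eq_square)
    then show ?thesis
      using False by (simp add: divide_simps power2_norm_eq_inner)
  qed (simp add: linear_0[OF lin])
  define v where "v = M f - c *\<^sub>R f"
  have v: "v \<in> U"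
    using f U inv by (simp add: v_def subspace_diff subspace_scale)
  have ff: "f \<bullet> f = 1"
    using f by (simp add: norm_eq_1)
  \<comment> \<open>The bound \<open>quad\<close> at \<open>f + t v\<close>, expanded in
    \<open>t\<close>. The constant terms cancel, and the first-order coefficient is twice the
    squared norm of the residual.\<close>
  have ub: "2 * t * (v \<bullet> v) + t\<^sup>2 * (M v \<bullet> v - c * (v \<bullet> v)) \<le> 0" for t
  proof -
    have "f + t *\<^sub>R v \<in> U"
      using f v U by (simp add: subspace_add subspace_scale)
    note quad[OF this]
    moreover have "M (f + t *\<^sub>R v) \<bullet> (f + t *\<^sub>R v) = M f \<bullet> f + 2 * t * (M f \<bullet> v) + t\<^sup>2 * (M v \<bullet> v)"
      using sym[of v f] f v
      by (simp add: linear_add[OF lin] linear_scale[OF lin] inner_add_left inner_add_right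
          power2_eq_square algebra_simps inner_commute[of v "M f"])
    moreover have "(f + t *\<^sub>R v) \<bullet> (f + t *\<^sub>R v) = 1 + 2 * t * (f \<bullet> v) + t\<^sup>2 * (v \<bullet> v)"
      using ff by (simp add: inner_add_left inner_add_right power2_eq_square algebra_simps
          inner_commute[of v f])
    ultimately have "M f \<bullet> f + 2 * t * (M f \<bullet> v) + t\<^sup>2 * (M v \<bullet> v)
        \<le> c * (1 + 2 * t * (f \<bullet> v) + t\<^sup>2 * (v \<bullet> v))"
      by simp
    moreover have "M f \<bullet> v = v \<bullet> v + c * (f \<bullet> v)"
      unfolding v_def by (simp add: inner_diff_left)
    ultimately show ?thesis
      by (simp add: c_def[symmetric] algebra_simps)
  qed
  have "v \<bullet> v = 0"
  proof (rule ccontr)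
    assume nz: "v \<bullet> v \<noteq> 0"
    then have pos: "0 < v \<bullet> v" by simp
    define b where "b = M v \<bullet> v - c * (v \<bullet> v)"
    \<comment> \<open>So small that the linear term outweighs the quadratic one; the summand 1
      covers \<open>b = 0\<close>.\<close>
    define t where "t = (v \<bullet> v) / (\<bar>b\<bar> + 1)"
    have t: "0 < t" "t * \<bar>b\<bar> < v \<bullet> v"
      using pos by (auto simp: t_def divide_simps algebra_simps add_pos_nonneg)
    then have "\<bar>t * b\<bar> < v \<bullet> v"
      by (simp add: abs_mult)
    then have "0 < 2 * (v \<bullet> v) + t * b"
      using pos by linarith
    then have "0 < t * (2 * (v \<bullet> v) + t * b)"
      using t by simp
    then show False
      using ub[of t] by (simp add: b_def power2_eq_square algebra_simps)
  qed
  then have "M f = c *\<^sub>R f"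
    by (simp add: v_def)
  moreover have "f \<noteq> 0" using ff by auto
  ultimately show ?thesis
    using f that by blast
qed

section \<open>Green's formula and the energy of the graph Laplacian\<close>

lemma graph_laplacian_nth:
  "graph_laplacian E w u $ x =
     (\<Sum>y\<in>UNIV. (if {x, y} \<in> E then w {x, y} else 0) * (u $ x - u $ y))"
  by (auto simp: graph_laplacian_def intro!: sum.mono_neutral_cong_left split: if_splits)

lemma linear_graph_laplacian: "linear (graph_laplacian E w)"
  by (intro linearI) (simp_all add: vec_eq_iff graph_laplacian_nth algebra_simps
      sum.distrib sum_distrib_left sum_subtractf)

text \<open>Green's formula: averaging the double sum with its copy under exchange of
  \<open>x\<close> and \<open>y\<close> turns \<open>v $ x\<close> into a difference. Each edge is
  counted in both orientations, hence the division by 2.\<close>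

lemma graph_laplacian_inner:
  "graph_laplacian E w u \<bullet> v =
     (\<Sum>x\<in>UNIV. \<Sum>y\<in>UNIV. (if {x, y} \<in> E then w {x, y} else 0) * (u $ x - u $ y) * (v $ x - v $ y)) / 2"
proof -
  define c where "c x y = (if {x, y} \<in> E then w {x, y} else 0)" for x y
  have c: "c x y = c y x" for x y
    by (simp add: c_def insert_commute)
  have 1: "graph_laplacian E w u \<bullet> v = (\<Sum>x\<in>UNIV. \<Sum>y\<in>UNIV. c x y * (u $ x - u $ y) * v $ x)"
    by (simp add: inner_vec_def graph_laplacian_nth c_def sum_distrib_right)
  also have "\<dots> = (\<Sum>y\<in>UNIV. \<Sum>x\<in>UNIV. c x y * (u $ x - u $ y) * v $ x)"
    by (rule sum.swap)
  \<comment> \<open>Renaming the variables and using the symmetry of \<open>c\<close> flips the sign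
    of the difference.\<close>
  also have "\<dots> = (\<Sum>x\<in>UNIV. \<Sum>y\<in>UNIV. - (c x y * (u $ x - u $ y) * v $ y))"
    by (subst c) (simp add: algebra_simps)
  finally have "2 * (graph_laplacian E w u \<bullet> v) = (\<Sum>x\<in>UNIV. \<Sum>y\<in>UNIV.
      c x y * (u $ x - u $ y) * v $ x) + (\<Sum>x\<in>UNIV. \<Sum>y\<in>UNIV. - (c x y * (u $ x - u $ y) * v $ y))"
    using 1 by simp
  also have "\<dots> = (\<Sum>x\<in>UNIV. \<Sum>y\<in>UNIV. c x y * (u $ x - u $ y) * (v $ x - v $ y))"
    by (simp add: sum.distrib[symmetric] algebra_simps)
  finally show ?thesis
    by (simp add: c_def)
qed

lemma graph_laplacian_self_adjoint:
  "graph_laplacian E w u \<bullet> v = u \<bullet> graph_laplacian E w v"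
  by (subst (2) inner_commute) (simp add: graph_laplacian_inner mult.commute mult.left_commute)

lemma graph_laplacian_energy_nonneg:
  assumes "\<And>e. e \<in> E \<Longrightarrow> 0 \<le> w e"
  shows "0 \<le> graph_laplacian E w h \<bullet> h"
  using assms by (auto simp: graph_laplacian_inner mult.assoc intro!: sum_nonneg)

text \<open>The energy is a sum of nonnegative terms, so each one vanishes and \<open>h\<close>
  agrees across every edge of positive weight. Weights may be zero, so the path must use edges of
  positive weight.\<close>

lemma energy_zero_imp_const:
  assumes nonneg: "\<And>e. e \<in> E \<Longrightarrow> 0 \<le> w e" and zero: "graph_laplacian E w h \<bullet> h = 0"
    and path: "(x, y) \<in> {(a, b). {a, b} \<in> E \<and> 0 < w {a, b}}\<^sup>*"
  shows "h $ y = h $ x"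
proof -
  define t where "t x y = (if {x, y} \<in> E then w {x, y} else 0) * (h $ x - h $ y) * (h $ x - h $ y)"
    for x y
  have t: "0 \<le> t x y" for x y
    using nonneg by (simp add: t_def mult.assoc)
  have "(\<Sum>x\<in>UNIV. \<Sum>y\<in>UNIV. t x y) = 0"
    using zero by (simp add: graph_laplacian_inner t_def)
  then have t0: "t x y = 0" for x y
    using t by (simp add: sum_nonneg_eq_0_iff sum_nonneg)
  show ?thesis
    using path
  proof (induction rule: rtrancl_induct)
    case (step y z)
    then show ?case using t0[of y z] by (auto simp: t_def)
  qed simp
qed

section \<open>Weights on rooted trees\<close>

text \<open>\<open>S\<close> is the vertex set of a tree in \<open>E\<close> rooted at
  \<open>r\<close>, built by repeatedly hanging one rooted tree from the root of another. Only the
  vertex set and the root are recorded.\<close>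

inductive joined :: "'v set set \<Rightarrow> 'v set \<Rightarrow> 'v \<Rightarrow> bool" for E where
  single: "joined E {r} r"
| join: "joined E S r \<Longrightarrow> joined E T c \<Longrightarrow> S \<inter> T = {} \<Longrightarrow> {r, c} \<in> E \<Longrightarrow> joined E (S \<union> T) r"

lemma joined_root: "joined E S r \<Longrightarrow> r \<in> S"
  by (induction rule: joined.induct) auto

text \<open>Strong induction on \<open>S\<close>. For a neighbour \<open>c\<close> of
  \<open>r\<close>, let \<open>T\<close> be the component of \<open>c\<close> in
  \<open>S - {r}\<close> and \<open>A\<close> that of \<open>r\<close> in \<open>S - T\<close>. Both
  live in smaller sets, and together they form the component of \<open>r\<close>.\<close>

lemma joined_component:
  assumes "finite S" "r \<in> S"
  shows "joined E ({(a, b). {a, b} \<in> E \<and> a \<in> S \<and> b \<in> S}\<^sup>* `` {r}) r"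
  using assms
proof (induction S arbitrary: r rule: finite_psubset_induct)
  case (psubset S)
  define R where "R A = {(a, b). {a, b} \<in> E \<and> a \<in> A \<and> b \<in> A}" for A
  have mono: "(R A)\<^sup>* \<subseteq> (R S)\<^sup>*" if "A \<subseteq> S" for A
    using that by (intro rtrancl_mono) (auto simp: R_def)
  have inside: "(R A)\<^sup>* `` {a} \<subseteq> A" if a: "a \<in> A" for A a
  proof safe
    fix x assume "(a, x) \<in> (R A)\<^sup>*"
    then show "x \<in> A"
      by (induction rule: rtrancl_induct) (use a in \<open>auto simp: R_def\<close>)
  qed
  show ?case
  proof (cases "\<exists>c. {r, c} \<in> E \<and> c \<in> S - {r}")
    case False
    have "x = r" if "(r, x) \<in> (R S)\<^sup>*" for x
      using that by (induction rule: rtrancl_induct) (use False in \<open>auto simp: R_def\<close>)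
    then have "(R S)\<^sup>* `` {r} = {r}" by auto
    then show ?thesis using joined.single by (simp add: R_def)
  next
    case True
    then obtain c where c: "{r, c} \<in> E" "c \<in> S" "c \<noteq> r" by auto
    define T where "T = (R (S - {r}))\<^sup>* `` {c}"
    have TS: "T \<subseteq> S - {r}"
      unfolding T_def using c by (intro inside) auto
    have cT: "c \<in> T" by (simp add: T_def)
    define A where "A = (R (S - T))\<^sup>* `` {r}"
    have AS: "A \<subseteq> S - T"
      unfolding A_def using psubset.prems TS by (intro inside) auto
    have "joined E T c"
      unfolding T_def R_def using c psubset.prems by (intro psubset.IH) auto
    moreover have "joined E A r"
      unfolding A_def R_def using c psubset.prems TS cT by (intro psubset.IH) auto
    ultimately have "joined E (A \<union> T) r"
      using AS c by (intro joined.join) auto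
    moreover have "A \<union> T = (R S)\<^sup>* `` {r}"
    proof (intro equalityI subsetI)
      fix x assume "x \<in> A \<union> T"
      moreover have "(r, c) \<in> R S" using c psubset.prems by (simp add: R_def)
      ultimately show "x \<in> (R S)\<^sup>* `` {r}"
        using mono[of "S - T"] mono[of "S - {r}"]
        by (auto simp: A_def T_def intro: converse_rtrancl_into_rtrancl)
    next
      fix x assume "x \<in> (R S)\<^sup>* `` {r}"
      then have "(r, x) \<in> (R S)\<^sup>*" by simp
      then show "x \<in> A \<union> T"
      proof (induction rule: rtrancl_induct)
        case base
        then show ?case by (simp add: A_def)
      next
        case (step y z)
        then have yz: "{y, z} \<in> E" "y \<in> S" "z \<in> S" by (auto simp: R_def)
        \<comment> \<open>An edge leaving \<open>T\<close> within \<open>S\<close> can only end in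
          \<open>r\<close>; an edge from \<open>A\<close> that avoids \<open>T\<close> stays in
          \<open>S - T\<close> and hence in \<open>A\<close>.\<close>
        consider "z \<in> T" | "z = r" | "y \<in> T" "z \<noteq> r" | "y \<in> A" "z \<notin> T"
          using step.IH by blast
        then show ?case
        proof cases
          case 2
          then show ?thesis by (simp add: A_def)
        next
          case 3
          then have "(y, z) \<in> R (S - {r})" using yz TS by (auto simp: R_def)
          then have "z \<in> T"
            using 3 unfolding T_def by (auto intro: rtrancl_into_rtrancl)
          then show ?thesis by simp
        next
          case 4
          then have "(y, z) \<in> R (S - T)" using yz AS by (auto simp: R_def)
          then have "z \<in> A"
            using 4 unfolding A_def by (auto intro: rtrancl_into_rtrancl)
          then show ?thesis by simp
        qed simp
      qed
    qed
    ultimately show ?thesis by (simp add: R_def)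
  qed
qed

lemma connected_graph_joined:
  fixes E :: "'v::finite set set"
  assumes "connected_graph E"
  shows "joined E UNIV r"
proof -
  have "{(a, b). {a, b} \<in> E}\<^sup>* `` {r} = UNIV"
    using assms by (auto simp: connected_graph_def)
  then show ?thesis
    using joined_component[of UNIV r E] by simp
qed

section \<open>Detecting eigenfunctions at the root of a tree\<close>

lemma graph_laplacian_local:
  assumes "\<And>e. w e \<noteq> 0 \<Longrightarrow> e \<subseteq> S" "x \<in> S" "\<And>y. y \<in> S \<Longrightarrow> u $ y = v $ y"
  shows "graph_laplacian E w u $ x = graph_laplacian E w v $ x"
  unfolding graph_laplacian_nth
proof (rule sum.cong)
  fix y
  show "(if {x, y} \<in> E then w {x, y} else 0) * (u $ x - u $ y) =
        (if {x, y} \<in> E then w {x, y} else 0) * (v $ x - v $ y)"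
    using assms(1)[of "{x, y}"] assms(2,3) by (cases "w {x, y} = 0") auto
qed simp

lemma graph_laplacian_outside:
  assumes "\<And>e. w e \<noteq> 0 \<Longrightarrow> e \<subseteq> S" "x \<notin> S"
  shows "graph_laplacian E w u $ x = 0"
  unfolding graph_laplacian_nth
proof (intro sum.neutral ballI)
  fix y
  show "(if {x, y} \<in> E then w {x, y} else 0) * (u $ x - u $ y) = 0"
    using assms(1)[of "{x, y}"] assms(2) by auto
qed

text \<open>The Steklov problem on \<open>S\<close> written for the extension \<open>h\<close>: the
  mass is 1 on \<open>B\<close> and 0 elsewhere, so the equation says harmonic off \<open>B\<close>.
  The edge set is \<open>UNIV\<close>, as the support of \<open>w\<close> selects the edges.\<close>

definition root_detecting :: "'v::finite set \<Rightarrow> ('v set \<Rightarrow> real) \<Rightarrow> 'v set \<Rightarrow> 'v \<Rightarrow> bool" where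
  "root_detecting B w S r \<longleftrightarrow> (\<forall>h \<mu>. h $ r = 0 \<longrightarrow>
     (\<forall>x\<in>S. graph_laplacian UNIV w h $ x = \<mu> * (if x \<in> B then h $ x else 0)) \<longrightarrow>
     (\<forall>x\<in>S. h $ x = 0))"

text \<open>
  Grounding the root of \<open>S\<close> and hanging \<open>T\<close> from it by an edge decouples the two parts: an
  eigenfunction vanishing at \<open>r\<close> but not on \<open>T\<close> would have an eigenvalue in both Dirichlet
  spectra. The weights on \<open>T\<close> are rescaled by \<open>s\<close> to make these finite spectra disjoint.
\<close>

lemma root_detecting_join:
  fixes w1 w2 :: "'v::finite set \<Rightarrow> real"
  assumes nonneg: "\<And>e. 0 \<le> w1 e" "\<And>e. 0 \<le> w2 e"
    and supp: "\<And>e. w1 e \<noteq> 0 \<Longrightarrow> e \<subseteq> S" "\<And>e. w2 e \<noteq> 0 \<Longrightarrow> e \<subseteq> T"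
    and path: "\<And>x. x \<in> S \<Longrightarrow> (r, x) \<in> {(a, b). 0 < w1 {a, b}}\<^sup>*"
      "\<And>x. x \<in> T \<Longrightarrow> (c, x) \<in> {(a, b). 0 < w2 {a, b}}\<^sup>*"
    and det: "root_detecting B w1 S r" "root_detecting B w2 T c"
    and ST: "S \<inter> T = {}" "r \<in> S" "c \<in> T"
  obtains s where "0 < s"
    "root_detecting B (\<lambda>e. w1 e + s * w2 e + (if e = {r, c} then s else 0)) (S \<union> T) r"
proof -
  let ?L = "graph_laplacian UNIV :: ('v set \<Rightarrow> real) \<Rightarrow> _"
  \<comment> \<open>The Dirichlet problem on \<open>S\<close> with \<open>r\<close> grounded. The
    identity rows, paired with zero rows of \<open>G1\<close>, force a solution of the pencil to
    vanish off \<open>S - {r}\<close>.\<close>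
  define F1 where "F1 h = (\<chi> x. if x \<in> S - {r} then ?L w1 h $ x else h $ x)" for h
  define G1 where "G1 h = (\<chi> x. if x \<in> S - {r} \<and> x \<in> B then h $ x else (0::real))" for h
  \<comment> \<open>The additional term at \<open>c\<close> is a unit edge to the grounded vertex
    \<open>r\<close>.\<close>
  define F2 where "F2 h = (\<chi> x. if x \<in> T then ?L w2 h $ x + (if x = c then h $ x else 0) else h $ x)"
    for h
  define G2 where "G2 h = (\<chi> x. if x \<in> T \<and> x \<in> B then h $ x else (0::real))" for h
  have lin: "linear F1" "linear G1" "linear F2" "linear G2"
    unfolding F1_def G1_def F2_def G2_def
    by (intro linearI; simp add: vec_eq_iff linear_add[OF linear_graph_laplacian]
        linear_scale[OF linear_graph_laplacian] algebra_simps)+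
  define \<sigma>1 where "\<sigma>1 = {\<nu>. \<exists>h. h \<noteq> 0 \<and> F1 h = \<nu> *\<^sub>R G1 h}"
  define \<sigma>2 where "\<sigma>2 = {\<nu>. \<exists>h. h \<noteq> 0 \<and> F2 h = \<nu> *\<^sub>R G2 h}"
  have inj1: "h = 0" if "F1 h = 0" for h
  proof -
    have F: "F1 h $ x = 0" for x using that by simp
    have off: "h $ x = 0" if "x \<notin> S - {r}" for x
      using F[of x] that by (auto simp: F1_def)
    have on: "?L w1 h $ x = 0" if "x \<in> S - {r}" for x
      using F[of x] that by (simp add: F1_def)
    have "?L w1 h \<bullet> h = 0"
      unfolding inner_vec_def using off on by (intro sum.neutral) auto
    then have "h $ x = h $ r" if "x \<in> S" for x
      using energy_zero_imp_const[of UNIV w1 h r x] nonneg path(1)[OF that] by simp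
    then show ?thesis
      using off by (metis Diff_iff insert_iff vec_eq_iff zero_index)
  qed
  have inj2: "h = 0" if "F2 h = 0" for h
  proof -
    have F: "F2 h $ x = 0" for x using that by simp
    have off: "h $ x = 0" if "x \<notin> T" for x
      using F[of x] that by (simp add: F2_def)
    have on: "?L w2 h $ x = (if x = c then - (h $ c) else 0)" if "x \<in> T" for x
      using F[of x] that by (auto simp: F2_def)
    have "?L w2 h \<bullet> h = (\<Sum>x\<in>UNIV. if x = c then - (h $ c * h $ c) else 0)"
      unfolding inner_vec_def
    proof (rule sum.cong)
      fix x
      show "?L w2 h $ x \<bullet> h $ x = (if x = c then - (h $ c * h $ c) else 0)"
        using off[of x] on[of x] ST by (cases "x \<in> T") auto
    qed simp
    also have "\<dots> = - (h $ c * h $ c)" by simp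
    finally have en: "?L w2 h \<bullet> h = - (h $ c * h $ c)" .
    moreover have "0 \<le> ?L w2 h \<bullet> h"
      using nonneg by (intro graph_laplacian_energy_nonneg)
    \<comment> \<open>A nonnegative energy equals minus a square, so both are zero.\<close>
    ultimately have c0: "h $ c * h $ c = 0"
      using zero_le_square[of "h $ c"] by linarith
    with en have "?L w2 h \<bullet> h = 0" by simp
    then have "h $ x = h $ c" if "x \<in> T" for x
      using energy_zero_imp_const[of UNIV w2 h c x] nonneg path(2)[OF that] by simp
    then show ?thesis
      using off c0 by (metis mult_eq_0_iff vec_eq_iff zero_index)
  qed
  have "finite \<sigma>1" "finite \<sigma>2"
    unfolding \<sigma>1_def \<sigma>2_def
    using finite_pencil_spectrum[OF lin(1,2) inj1] finite_pencil_spectrum[OF lin(3,4) inj2] by auto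
  then have "finite ((\<lambda>(a, b). a / b) ` (\<sigma>1 \<times> \<sigma>2))" by simp
  then have "infinite ({0<..} - (\<lambda>(a, b). a / b) ` (\<sigma>1 \<times> \<sigma>2))"
    by (intro Diff_infinite_finite infinite_Ioi)
  then obtain s where s: "0 < s" "s \<notin> (\<lambda>(a, b). a / b) ` (\<sigma>1 \<times> \<sigma>2)"
    using infinite_imp_nonempty by blast
  \<comment> \<open>A common value would give \<open>s = \<mu> / (\<mu> / s)\<close>, an excluded
    quotient; \<mu> is nonzero since \<open>F2\<close> is injective.\<close>
  have disj: "\<not> (\<mu> \<in> \<sigma>1 \<and> \<mu> / s \<in> \<sigma>2)" for \<mu>
  proof safe
    assume \<mu>: "\<mu> \<in> \<sigma>1" "\<mu> / s \<in> \<sigma>2"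
    obtain h where "h \<noteq> 0" "F2 h = (\<mu> / s) *\<^sub>R G2 h"
      using \<mu>(2) unfolding \<sigma>2_def by blast
    then have "\<mu> \<noteq> 0"
      using inj2[of h] by auto
    then have "s = \<mu> / (\<mu> / s)" using s(1) by simp
    then show False using \<mu> s(2) by (metis (no_types, lifting) SigmaI case_prod_conv image_eqI)
  qed
  \<comment> \<open>The connecting edge carries the same factor \<open>s\<close> as
    \<open>w2\<close>. For \<open>h $ r = 0\<close> the equations on \<open>T\<close> are thus
    \<open>s\<close> times those of the pencil \<open>F2\<close>, \<open>G2\<close> at \<mu> /
    s.\<close>
  define w where "w = (\<lambda>e. w1 e + s * w2 e + (if e = {r, c} then s else 0))"
  have rc: "r \<noteq> c" using ST by auto
  have out1: "?L w1 h $ x = 0" if "x \<notin> S" for x h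
    using supp(1) that by (rule graph_laplacian_outside)
  have out2: "?L w2 h $ x = 0" if "x \<notin> T" for x h
    using supp(2) that by (rule graph_laplacian_outside)
  have split: "?L w h $ x = ?L w1 h $ x + s * ?L w2 h $ x +
      s * ((if x = r then h $ r - h $ c else 0) + (if x = c then h $ c - h $ r else 0))" for h x
  proof -
    have "(\<Sum>y\<in>UNIV. (if {x, y} = {r, c} then s else 0) * (h $ x - h $ y)) =
        (\<Sum>y\<in>UNIV. (if y = c then if x = r then s * (h $ r - h $ c) else 0 else 0) +
          (if y = r then if x = c then s * (h $ c - h $ r) else 0 else 0))"
      using rc by (intro sum.cong) (auto simp: doubleton_eq_iff)
    also have "\<dots> = s * ((if x = r then h $ r - h $ c else 0) + (if x = c then h $ c - h $ r else 0))"
      by (simp add: sum.distrib)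
    finally show ?thesis
      by (simp add: graph_laplacian_nth w_def distrib_right sum.distrib sum_distrib_left mult.assoc)
  qed
  have "root_detecting B w (S \<union> T) r"
    unfolding root_detecting_def
  proof (intro allI impI)
    fix h \<mu>
    assume r0: "h $ r = 0"
      and "\<forall>x\<in>S \<union> T. ?L w h $ x = \<mu> * (if x \<in> B then h $ x else 0)"
    then have eig: "?L w h $ x = \<mu> * (if x \<in> B then h $ x else 0)" if "x \<in> S \<union> T" for x
      using that by blast
    have eig1: "?L w1 h $ x + (if x = r then - (s * h $ c) else 0) = \<mu> * (if x \<in> B then h $ x else 0)"
      if "x \<in> S" for x
    proof -
      have "x \<notin> T" "x \<noteq> c" using that ST by auto
      then show ?thesis
        using eig[of x] that out2[of x h] by (auto simp: split r0 cong: if_cong)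
    qed
    have eig2: "?L w2 h $ x + (if x = c then h $ c else 0) = \<mu> / s * (if x \<in> B then h $ x else 0)"
      if "x \<in> T" for x
    proof -
      have "x \<notin> S" "x \<noteq> r" using that ST by auto
      then have "s * (?L w2 h $ x + (if x = c then h $ c else 0)) = \<mu> * (if x \<in> B then h $ x else 0)"
        using eig[of x] that out1[of x h]
        by (auto simp: split r0 distrib_left cong: if_cong)
      then show ?thesis using s(1) by (simp add: field_simps)
    qed
    have c0: "h $ c = 0"
    proof (rule ccontr)
      assume c: "h $ c \<noteq> 0"
      define h2 where "h2 = (\<chi> x. if x \<in> T then h $ x else 0)"
      have L2: "?L w2 h2 $ x = ?L w2 h $ x" if "x \<in> T" for x
        using that by (intro graph_laplacian_local[OF supp(2)]) (auto simp: h2_def)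
      have "F2 h2 $ x = ((\<mu> / s) *\<^sub>R G2 h2) $ x" for x
        using eig2[of x] L2[of x] by (cases "x \<in> T") (auto simp: F2_def G2_def h2_def)
      then have "F2 h2 = (\<mu> / s) *\<^sub>R G2 h2"
        by (simp add: vec_eq_iff)
      moreover have "h2 \<noteq> 0"
        using c ST by (auto simp: vec_eq_iff h2_def)
      ultimately have "\<mu> / s \<in> \<sigma>2" by (auto simp: \<sigma>2_def)
      define h1 where "h1 = (\<chi> x. if x \<in> S then h $ x else 0)"
      have L1: "?L w1 h1 $ x = ?L w1 h $ x" if "x \<in> S" for x
        using that by (intro graph_laplacian_local[OF supp(1)]) (auto simp: h1_def)
      have "F1 h1 $ x = (\<mu> *\<^sub>R G1 h1) $ x" for x
        using eig1[of x] L1[of x] r0 by (cases "x \<in> S") (auto simp: F1_def G1_def h1_def)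
      then have "F1 h1 = \<mu> *\<^sub>R G1 h1"
        by (simp add: vec_eq_iff)
      \<comment> \<open>The current \<open>s * h $ c\<close> through the connecting edge must be
        balanced at \<open>r\<close> by \<open>w1\<close>, so \<open>h\<close> cannot vanish on all
        of \<open>S\<close>.\<close>
      moreover have "h1 \<noteq> 0"
      proof
        assume "h1 = 0"
        then have "?L w1 h $ r = 0"
          using L1[of r] ST by (simp add: linear_0[OF linear_graph_laplacian])
        then show False
          using eig1[of r] ST r0 c s(1) by (simp split: if_splits)
      qed
      ultimately have "\<mu> \<in> \<sigma>1" by (auto simp: \<sigma>1_def)
      with \<open>\<mu> / s \<in> \<sigma>2\<close> disj show False by blast
    qed
    \<comment> \<open>With both its ends at 0 the connecting edge drops out, and each part satisfies
      its own eigenvalue equation.\<close>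
    have "?L w2 h $ x = \<mu> / s * (if x \<in> B then h $ x else 0)" if "x \<in> T" for x
      using eig2[OF that] c0 by (cases "x = c") auto
    then have "\<forall>x\<in>T. h $ x = 0"
      using det(2) c0 unfolding root_detecting_def by blast
    moreover have "?L w1 h $ x = \<mu> * (if x \<in> B then h $ x else 0)" if "x \<in> S" for x
      using eig1[OF that] c0 by (cases "x = r") auto
    then have "\<forall>x\<in>S. h $ x = 0"
      using det(1) r0 unfolding root_detecting_def by blast
    ultimately show "\<forall>x\<in>S \<union> T. h $ x = 0" by blast
  qed
  then show ?thesis
    using s(1) that by (simp add: w_def)
qed

text \<open>Induction over the construction of the tree with \<open>root_detecting_join\<close>.
  Nonnegativity, support and connectedness by positive weights are carried along because joining
  requires them.\<close>

lemma joined_root_detecting: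
  fixes E :: "'v::finite set set"
  assumes "joined E S r"
  obtains w where "\<And>e. 0 \<le> w e" "\<And>e. w e \<noteq> 0 \<Longrightarrow> e \<in> E \<and> e \<subseteq> S"
    "\<And>x. x \<in> S \<Longrightarrow> (r, x) \<in> {(a, b). 0 < w {a, b}}\<^sup>*" "root_detecting B w S r"
  using assms
proof (induction arbitrary: thesis rule: joined.induct)
  case (single r)
  show ?case
    by (rule single[of "\<lambda>_. 0"]) (auto simp: root_detecting_def)
next
  case (join S r T c)
  obtain w1 where w1: "\<And>e. 0 \<le> w1 e" "\<And>e. w1 e \<noteq> 0 \<Longrightarrow> e \<in> E \<and> e \<subseteq> S"
    "\<And>x. x \<in> S \<Longrightarrow> (r, x) \<in> {(a, b). 0 < w1 {a, b}}\<^sup>*" "root_detecting B w1 S r"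
    using join.IH(1) by blast
  obtain w2 where w2: "\<And>e. 0 \<le> w2 e" "\<And>e. w2 e \<noteq> 0 \<Longrightarrow> e \<in> E \<and> e \<subseteq> T"
    "\<And>x. x \<in> T \<Longrightarrow> (c, x) \<in> {(a, b). 0 < w2 {a, b}}\<^sup>*" "root_detecting B w2 T c"
    using join.IH(2) by blast
  have root: "r \<in> S" "c \<in> T"
    using join.hyps by (auto intro: joined_root)
  obtain s where s: "0 < s"
    "root_detecting B (\<lambda>e. w1 e + s * w2 e + (if e = {r, c} then s else 0)) (S \<union> T) r"
    using root_detecting_join[of w1 w2 S T r c B] w1 w2 join.hyps root by blast
  define w where "w = (\<lambda>e. w1 e + s * w2 e + (if e = {r, c} then s else 0))"
  have le: "w1 e \<le> w e" "s * w2 e \<le> w e" for e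
    using w1(1)[of e] w2(1)[of e] s(1) by (auto simp: w_def)
  have pos: "0 < w e" if "0 < w1 e \<or> 0 < w2 e" for e
    using that le[of e] s(1) by (meson less_le_trans mult_pos_pos)
  let ?R = "{(a, b). 0 < w {a, b}}\<^sup>*"
  have mono: "{(a, b). 0 < w1 {a, b}}\<^sup>* \<subseteq> ?R" "{(a, b). 0 < w2 {a, b}}\<^sup>* \<subseteq> ?R"
    using pos by (intro rtrancl_mono; blast)+
  have "0 < w {r, c}"
    using w1(1)[of "{r, c}"] w2(1)[of "{r, c}"] s(1) by (simp add: w_def add_nonneg_pos)
  then have "(r, x) \<in> ?R" if "x \<in> S \<union> T" for x
    using that w1(3)[of x] w2(3)[of x] mono by (auto intro: converse_rtrancl_into_rtrancl)
  moreover have "e \<in> E \<and> e \<subseteq> S \<union> T" if "w e \<noteq> 0" for e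
    using that w1(2)[of e] w2(2)[of e] join.hyps root
    by (cases "w1 e = 0"; cases "w2 e = 0") (auto simp: w_def split: if_splits)
  moreover have "0 \<le> w e" for e
    using w1(1)[of e] le[of e] by linarith
  ultimately show ?case
    using join.prems[of w] s(2) by (simp add: w_def)
qed

section \<open>The Steklov operator and its Krylov vectors\<close>

lemma poly_on_graph_laplacian:
  assumes "\<And>x. poly_on E (\<lambda>w. u w $ x)"
  shows "poly_on E (\<lambda>w. graph_laplacian E w (u w) $ x)"
  unfolding graph_laplacian_nth
  by (intro poly_on_sum poly_on.mult poly_on_diff poly_on_if assms poly_on.coord poly_on.const)

lemma normal_derivative_nth:
  "normal_derivative E B w u $ x = (if x \<in> B then graph_laplacian E w u $ x else 0)"
  by (simp add: normal_derivative_def graph_laplacian_def)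

lemma linear_normal_derivative: "linear (normal_derivative E B w)"
  by (intro linearI) (simp_all add: vec_eq_iff normal_derivative_nth
      linear_add[OF linear_graph_laplacian] linear_scale[OF linear_graph_laplacian])

lemma normal_derivative_in_boundary_space: "normal_derivative E B w u \<in> boundary_space B"
  by (simp add: boundary_space_def normal_derivative_nth)

lemma subspace_boundary_space: "subspace (boundary_space B)"
  by (simp add: subspace_def boundary_space_def)

section \<open>Harmonic extension by Cramer's rule\<close>

text \<open>The boundary value problem as one square system: for \<open>f\<close> in
  \<open>boundary_space B\<close>, solving it with right-hand side \<open>f\<close> means extending
  \<open>f\<close> harmonically.\<close>

definition dirichlet_matrix ::
  "'v::finite set set \<Rightarrow> 'v set \<Rightarrow> ('v set \<Rightarrow> real) \<Rightarrow> real ^ 'v ^ 'v" where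
  "dirichlet_matrix E B w = matrix (\<lambda>h. \<chi> x. if x \<in> B then h $ x else graph_laplacian E w h $ x)"

lemma dirichlet_matrix_mult:
  "(dirichlet_matrix E B w *v h) $ x = (if x \<in> B then h $ x else graph_laplacian E w h $ x)"
proof -
  have "linear (\<lambda>h. \<chi> x. if x \<in> B then h $ x else graph_laplacian E w h $ x)"
    by (intro linearI) (simp_all add: vec_eq_iff linear_add[OF linear_graph_laplacian]
        linear_scale[OF linear_graph_laplacian])
  then show ?thesis
    by (simp add: dirichlet_matrix_def matrix_works)
qed

text \<open>A kernel vector is zero on \<open>B\<close> and harmonic off \<open>B\<close>, so it has
  zero energy, is constant along the paths from \<open>b\<close>, and vanishes. Zero weights are
  allowed so that the tree weights are covered too.\<close>

lemma det_dirichlet_matrix_nonzero: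
  assumes nonneg: "\<And>e. e \<in> E \<Longrightarrow> 0 \<le> w e" and b: "b \<in> B"
    and path: "\<And>x. (b, x) \<in> {(x, y). {x, y} \<in> E \<and> 0 < w {x, y}}\<^sup>*"
  shows "det (dirichlet_matrix E B w) \<noteq> 0"
proof -
  have "h = 0" if "dirichlet_matrix E B w *v h = 0" for h
  proof -
    have *: "(if x \<in> B then h $ x else graph_laplacian E w h $ x) = 0" for x
      using that by (metis dirichlet_matrix_mult zero_index)
    then have "graph_laplacian E w h \<bullet> h = 0"
      unfolding inner_vec_def by (intro sum.neutral) (metis inner_real_def mult_eq_0_iff)
    then have "h $ x = h $ b" for x
      using energy_zero_imp_const[of E w h b x] nonneg path by blast
    then show ?thesis
      using *[of b] b by (simp add: vec_eq_iff)
  qed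
  then show ?thesis
    by (simp add: invertible_det_nz[symmetric] invertible_left_inverse matrix_left_invertible_ker)
qed

text \<open>
  By Cramer's rule this is the harmonic extension of \<open>f\<close> times the determinant of
  \<^term>\<open>dirichlet_matrix E B w\<close>, so that it is polynomial in \<open>w\<close>.
\<close>

definition cramer_extension ::
  "'v::finite set set \<Rightarrow> 'v set \<Rightarrow> ('v set \<Rightarrow> real) \<Rightarrow> real ^ 'v \<Rightarrow> real ^ 'v" where
  "cramer_extension E B w f =
     (\<chi> k. det (\<chi> i j. if j = k then f $ i else dirichlet_matrix E B w $ i $ j))"

lemma poly_on_cramer_extension:
  assumes "\<And>x. poly_on E (\<lambda>w. f w $ x)"
  shows "poly_on E (\<lambda>w. cramer_extension E B w (f w) $ x)"
  unfolding cramer_extension_def dirichlet_matrix_def matrix_def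
  by (auto intro!: poly_on_det poly_on_if assms poly_on_graph_laplacian poly_on.const)

lemma dirichlet_matrix_cramer_extension:
  assumes "det (dirichlet_matrix E B w) \<noteq> 0"
  shows "dirichlet_matrix E B w *v cramer_extension E B w f = det (dirichlet_matrix E B w) *\<^sub>R f"
proof -
  let ?A = "dirichlet_matrix E B w"
  define u where "u = (\<chi> k. det (\<chi> i j. if j = k then f $ i else ?A $ i $ j) / det ?A)"
  have "?A *v u = f"
    using cramer[OF assms] by (simp add: u_def)
  moreover have "cramer_extension E B w f = det ?A *\<^sub>R u"
    using assms by (simp add: vec_eq_iff cramer_extension_def u_def)
  ultimately show ?thesis
    by (simp add: matrix_vector_mult_scaleR)
qed

lemma linear_cramer_extension:
  assumes "det (dirichlet_matrix E B w) \<noteq> 0"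
  shows "linear (cramer_extension E B w)"
proof -
  have inj: "u = v" if "dirichlet_matrix E B w *v u = dirichlet_matrix E B w *v v" for u v
    using assms that inj_matrix_vector_mult[of "dirichlet_matrix E B w"]
    by (auto simp: invertible_det_nz inj_def)
  show ?thesis
    by (rule linearI; rule inj)
      (simp_all add: dirichlet_matrix_cramer_extension[OF assms] matrix_vector_right_distrib
        matrix_vector_mult_scaleR scaleR_add_right)
qed

lemma cramer_extension_boundary:
  assumes "det (dirichlet_matrix E B w) \<noteq> 0" "x \<in> B"
  shows "cramer_extension E B w f $ x = det (dirichlet_matrix E B w) * f $ x"
  using dirichlet_matrix_mult[of E B w "cramer_extension E B w f" x] assms
  by (simp add: dirichlet_matrix_cramer_extension)

lemma cramer_extension_harmonic:
  assumes "det (dirichlet_matrix E B w) \<noteq> 0" "f \<in> boundary_space B" "x \<notin> B"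
  shows "graph_laplacian E w (cramer_extension E B w f) $ x = 0"
  using dirichlet_matrix_mult[of E B w "cramer_extension E B w f" x] assms
  by (simp add: dirichlet_matrix_cramer_extension boundary_space_def)

text \<open>The Steklov operator multiplied by the determinant of the Dirichlet matrix. It preserves
  polynomial dependence on the weights and, when the determinant is nonzero, has the same
  eigenfunctions in \<open>boundary_space B\<close>.\<close>

definition scaled_steklov ::
  "'v::finite set set \<Rightarrow> 'v set \<Rightarrow> ('v set \<Rightarrow> real) \<Rightarrow> real ^ 'v \<Rightarrow> real ^ 'v" where
  "scaled_steklov E B w f = normal_derivative E B w (cramer_extension E B w f)"

lemma linear_scaled_steklov:
  assumes "det (dirichlet_matrix E B w) \<noteq> 0"
  shows "linear (scaled_steklov E B w)"
  using linear_compose[OF linear_cramer_extension[OF assms] linear_normal_derivative[of E B w]]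
  by (simp add: scaled_steklov_def[abs_def] o_def)

lemma scaled_steklov_eq:
  assumes "det (dirichlet_matrix E B w) \<noteq> 0" "f \<in> boundary_space B"
  shows "scaled_steklov E B w f = det (dirichlet_matrix E B w) *\<^sub>R steklov_operator E B w f"
proof -
  let ?d = "det (dirichlet_matrix E B w)" and ?u = "cramer_extension E B w f"
  have "harmonic_extension E B w f = (1 / ?d) *\<^sub>R ?u"
    unfolding harmonic_extension_def
  proof (rule the_equality)
    show "(\<forall>x\<in>B. ((1 / ?d) *\<^sub>R ?u) $ x = f $ x) \<and>
        (\<forall>x\<in>- B. graph_laplacian E w ((1 / ?d) *\<^sub>R ?u) $ x = 0)"
      using assms by (simp add: cramer_extension_boundary cramer_extension_harmonic
          linear_scale[OF linear_graph_laplacian])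
  next
    fix h
    assume "(\<forall>x\<in>B. h $ x = f $ x) \<and> (\<forall>x\<in>- B. graph_laplacian E w h $ x = 0)"
    then have "dirichlet_matrix E B w *v h = f"
      using assms(2) by (auto simp: vec_eq_iff dirichlet_matrix_mult boundary_space_def)
    also have "f = dirichlet_matrix E B w *v ((1 / ?d) *\<^sub>R ?u)"
      using assms(1) by (simp add: matrix_vector_mult_scaleR dirichlet_matrix_cramer_extension)
    finally show "h = (1 / ?d) *\<^sub>R ?u"
      using assms(1) inj_matrix_vector_mult[of "dirichlet_matrix E B w"]
      by (auto simp: invertible_det_nz inj_def)
  qed
  then show ?thesis
    using assms(1) by (simp add: scaled_steklov_def steklov_operator_def
        linear_scale[OF linear_normal_derivative])
qed

text \<open>Off \<open>B\<close> the extension of \<open>f\<close> is harmonic, and on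
  \<open>B\<close> that of \<open>g\<close> is a multiple of \<open>g\<close>. So up to the
  determinant the pairing is the symmetric energy form of the two extensions.\<close>

lemma scaled_steklov_self_adjoint:
  assumes "det (dirichlet_matrix E B w) \<noteq> 0" and fg: "f \<in> boundary_space B" "g \<in> boundary_space B"
  shows "scaled_steklov E B w f \<bullet> g = f \<bullet> scaled_steklov E B w g"
proof -
  let ?d = "det (dirichlet_matrix E B w)" and ?H = "cramer_extension E B w"
  have green: "?d * (scaled_steklov E B w f \<bullet> g) = graph_laplacian E w (?H f) \<bullet> ?H g"
    if "f \<in> boundary_space B" "g \<in> boundary_space B" for f g
    unfolding inner_vec_def sum_distrib_left
  proof (rule sum.cong)
    fix x
    show "?d * (scaled_steklov E B w f $ x \<bullet> g $ x) = graph_laplacian E w (?H f) $ x \<bullet> ?H g $ x"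
      using that assms(1) by (cases "x \<in> B")
        (auto simp: scaled_steklov_def normal_derivative_nth cramer_extension_boundary
          cramer_extension_harmonic)
  qed simp
  have "?d * (scaled_steklov E B w f \<bullet> g) = ?d * (f \<bullet> scaled_steklov E B w g)"
    using green[OF fg] green[OF fg(2,1)] graph_laplacian_self_adjoint[of E w "?H f" "?H g"]
    by (simp add: inner_commute)
  then show ?thesis using assms(1) by simp
qed

lemma root_detecting_scaled_steklov:
  assumes det: "det (dirichlet_matrix E B w) \<noteq> 0" and "root_detecting B w UNIV x" "x \<in> B"
    and supp: "\<And>e. w e \<noteq> 0 \<Longrightarrow> e \<in> E"
    and f: "f \<in> boundary_space B" "scaled_steklov E B w f = c *\<^sub>R f" "f $ x = 0"
  shows "f = 0"
proof -
  let ?d = "det (dirichlet_matrix E B w)"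
  define h where "h = cramer_extension E B w f"
  have hB: "h $ y = ?d * f $ y" if "y \<in> B" for y
    using that det by (simp add: h_def cramer_extension_boundary)
  have "graph_laplacian UNIV w h = graph_laplacian E w h"
    unfolding vec_eq_iff graph_laplacian_nth using supp by (intro allI sum.cong) auto
  \<comment> \<open>On \<open>B\<close> the extension \<open>h\<close> is \<open>?d\<close> times
    \<open>f\<close>, hence the eigenvalue \<open>c / ?d\<close>.\<close>
  moreover have "graph_laplacian E w h $ y = c / ?d * (if y \<in> B then h $ y else 0)" for y
  proof (cases "y \<in> B")
    case True
    have "scaled_steklov E B w f $ y = c * f $ y" using f(2) by simp
    then show ?thesis
      using True det hB by (simp add: scaled_steklov_def normal_derivative_nth h_def)
  next
    case False
    then show ?thesis using det f(1) by (simp add: h_def cramer_extension_harmonic)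
  qed
  moreover have "h $ x = 0" using hB assms by simp
  ultimately have h0: "h $ y = 0" for y
    using assms(2)[unfolded root_detecting_def, rule_format, of h "c / ?d" y] by simp
  have "f $ y = 0" for y
    using hB[of y] h0[of y] det f(1) by (cases "y \<in> B") (auto simp: boundary_space_def)
  then show ?thesis
    by (simp add: vec_eq_iff)
qed

section \<open>Krylov vectors and cyclicity\<close>

definition krylov ::
  "'v::finite set set \<Rightarrow> 'v set \<Rightarrow> ('v set \<Rightarrow> real) \<Rightarrow> 'v \<Rightarrow> nat \<Rightarrow> real ^ 'v" where
  "krylov E B w x k = (scaled_steklov E B w ^^ k) (axis x 1)"

text \<open>Unit rows off \<open>B\<close> make the matrix square. For \<open>x\<close> in
  \<open>B\<close> it is invertible exactly when the selected Krylov vectors form a basis of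
  \<open>boundary_space B\<close>. The exponents \<kappa> are left free, so any basis drawn from the
  Krylov vectors can be used.\<close>

definition krylov_matrix ::
  "'v::finite set set \<Rightarrow> 'v set \<Rightarrow> ('v set \<Rightarrow> real) \<Rightarrow> 'v \<Rightarrow> ('v \<Rightarrow> nat) \<Rightarrow> real ^ 'v ^ 'v" where
  "krylov_matrix E B w x \<kappa> = (\<chi> z. if z \<in> B then krylov E B w x (\<kappa> z) else axis z 1)"

lemma poly_on_krylov: "poly_on E (\<lambda>w. krylov E B w x k $ y)"
proof (induction k arbitrary: y)
  case 0
  then show ?case by (simp add: krylov_def poly_on.const)
next
  case (Suc k)
  have "krylov E B w x (Suc k) $ y =
      (if y \<in> B then graph_laplacian E w (cramer_extension E B w (krylov E B w x k)) $ y else 0)" for w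
    by (simp add: krylov_def scaled_steklov_def normal_derivative_nth)
  then show ?case
    using Suc by (cases "y \<in> B") (auto intro!: poly_on_graph_laplacian poly_on_cramer_extension poly_on.const)
qed

lemma poly_on_det_krylov_matrix: "poly_on E (\<lambda>w. det (krylov_matrix E B w x \<kappa>))"
proof (rule poly_on_det)
  show "poly_on E (\<lambda>w. krylov_matrix E B w x \<kappa> $ i $ j)" for i j
    by (cases "i \<in> B") (auto simp: krylov_matrix_def intro: poly_on_krylov poly_on.const)
qed

lemma krylov_in_boundary_space: "x \<in> B \<Longrightarrow> krylov E B w x k \<in> boundary_space B"
  by (cases k) (auto simp: krylov_def scaled_steklov_def normal_derivative_in_boundary_space,
      auto simp: boundary_space_def axis_def)

lemma krylov_inner_Suc:
  assumes "det (dirichlet_matrix E B w) \<noteq> 0" "x \<in> B" "f \<in> boundary_space B"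
  shows "krylov E B w x (Suc k) \<bullet> f = krylov E B w x k \<bullet> scaled_steklov E B w f"
  using scaled_steklov_self_adjoint[OF assms(1) krylov_in_boundary_space assms(3)] assms(2)
  by (simp add: krylov_def)

text \<open>By self-adjointness the \<open>k\<close>-th Krylov vector pairs with \<open>f\<close> to
  \<open>c ^ k * f $ x = 0\<close>, so \<open>f\<close> is orthogonal to every row.\<close>

lemma krylov_matrix_detects:
  assumes "det (dirichlet_matrix E B w) \<noteq> 0" "det (krylov_matrix E B w x \<kappa>) \<noteq> 0" "x \<in> B"
    and f: "f \<in> boundary_space B" "scaled_steklov E B w f = c *\<^sub>R f" "f $ x = 0"
  shows "f = 0"
proof -
  have "krylov E B w x k \<bullet> f = 0" for k
  proof (induction k)
    case 0
    then show ?case using f by (simp add: krylov_def inner_axis')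
  next
    case (Suc k)
    then show ?case using assms by (simp add: krylov_inner_Suc)
  qed
  then have "krylov_matrix E B w x \<kappa> *v f = 0"
    using f(1) by (auto simp: vec_eq_iff matrix_vector_mul_component krylov_matrix_def inner_axis'
        boundary_space_def)
  then show ?thesis
    using assms(2) inj_matrix_vector_mult[of "krylov_matrix E B w x \<kappa>"]
    by (metis injD invertible_det_nz matrix_vector_mult_0_right)
qed

text \<open>If the Krylov vectors did not span, their orthogonal complement in
  \<open>boundary_space B\<close> would be a nonzero invariant subspace and contain an eigenvector.
  Being orthogonal to the indicator of \<open>x\<close>, it would vanish at
  \<open>x\<close>.\<close>

lemma krylov_matrix_exists:
  assumes det: "det (dirichlet_matrix E B w) \<noteq> 0" and x: "x \<in> B"
    and detects: "\<And>f c. f \<in> boundary_space B \<Longrightarrow> scaled_steklov E B w f = c *\<^sub>R f \<Longrightarrow> f $ x = 0 \<Longrightarrow> f = 0"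
  obtains \<kappa> where "det (krylov_matrix E B w x \<kappa>) \<noteq> 0"
proof -
  define K where "K = range (krylov E B w x)"
  define A where "A = (\<lambda>z. axis z (1::real)) ` (- B)"
  have span: "span (A \<union> K) = UNIV"
  proof (rule ccontr)
    assume "span (A \<union> K) \<noteq> UNIV"
    then obtain g where g: "g \<noteq> 0" "span (A \<union> K) \<subseteq> {y. g \<bullet> y = 0}"
      using span_not_univ_subset_hyperplane by blast
    then have orth: "g \<bullet> y = 0" if "y \<in> A \<union> K" for y
      using that span_base by blast
    define U where "U = {f \<in> boundary_space B. \<forall>k. krylov E B w x k \<bullet> f = 0}"
    have "g \<in> boundary_space B"
      unfolding boundary_space_def
    proof safe
      fix z assume "z \<notin> B"
      then show "g $ z = 0"
        using orth[of "axis z 1"] by (simp add: A_def inner_axis)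
    qed
    then have "g \<in> U"
      by (simp add: U_def K_def orth inner_commute[of _ g])
    have "subspace U"
      using subspace_boundary_space[of B] by (simp add: U_def subspace_def inner_add_right)
    moreover have "linear (scaled_steklov E B w)"
      using det by (rule linear_scaled_steklov)
    moreover have "scaled_steklov E B w f \<in> U" if "f \<in> U" for f
      using that krylov_inner_Suc[OF det x, of f]
      by (auto simp: U_def scaled_steklov_def normal_derivative_in_boundary_space)
    moreover have "scaled_steklov E B w f \<bullet> f' = f \<bullet> scaled_steklov E B w f'"
      if "f \<in> U" "f' \<in> U" for f f'
      using that scaled_steklov_self_adjoint[OF det] by (simp add: U_def)
    ultimately obtain f c where f: "f \<in> U" "f \<noteq> 0" "scaled_steklov E B w f = c *\<^sub>R f"
      using self_adjoint_has_eigenvector[of "scaled_steklov E B w" U g] \<open>g \<in> U\<close> g(1) by blast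
    have "krylov E B w x 0 \<bullet> f = 0" using f(1) by (simp add: U_def)
    then have "f $ x = 0" by (simp add: krylov_def inner_axis')
    then show False using f detects by (auto simp: U_def)
  qed
  have "A \<subseteq> Basis" by (auto simp: A_def axis_in_Basis_iff)
  then have "independent A"
    using independent_Basis independent_mono by blast
  \<comment> \<open>Extending \<open>A\<close> keeps all unit vectors off \<open>B\<close> in the
    basis, so \<open>C - A\<close> consists of exactly \<open>card B\<close> Krylov vectors.\<close>
  then obtain C where C: "A \<subseteq> C" "C \<subseteq> A \<union> K" "independent C" "A \<union> K \<subseteq> span C"
    using maximal_independent_subset_extend[of A "A \<union> K"] by blast
  have spanC: "span C = UNIV"
    using span_mono[OF C(4)] span by (simp add: span_span top_unique)
  have finC: "finite C" using C(3) by (rule independent_imp_finite)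
  have "card C = CARD('a)"
    using dim_span_eq_card_independent[OF C(3)] spanC by simp
  moreover have "card A = card (- B)"
    unfolding A_def by (intro card_image inj_onI) (simp add: axis_eq_axis)
  ultimately have "card (C - A) = CARD('a) - card (- B)"
    using C(1) finC by (simp add: card_Diff_subset finite_subset)
  also have "\<dots> = card B"
    by (simp add: Compl_eq_Diff_UNIV card_Diff_subset card_mono)
  finally obtain \<phi> where \<phi>: "bij_betw \<phi> B (C - A)"
    using finite_same_card_bij[of B "C - A"] finC by auto
  have "\<forall>z\<in>B. \<exists>k. \<phi> z = krylov E B w x k"
    using \<phi> C(2) by (fastforce simp: bij_betw_def K_def)
  then obtain \<kappa> where \<kappa>: "\<And>z. z \<in> B \<Longrightarrow> \<phi> z = krylov E B w x (\<kappa> z)"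
    by metis
  have "h = 0" if h: "krylov_matrix E B w x \<kappa> *v h = 0" for h
  proof -
    have row: "krylov_matrix E B w x \<kappa> $ z \<bullet> h = 0" for z
      using h by (metis matrix_vector_mul_component zero_index)
    have "y \<bullet> h = 0" if y: "y \<in> C" for y
    proof (cases "y \<in> A")
      case True
      then obtain z where "z \<notin> B" "y = axis z 1" by (auto simp: A_def)
      then show ?thesis using row[of z] by (simp add: krylov_matrix_def)
    next
      case False
      then obtain z where "z \<in> B" "y = \<phi> z"
        using \<phi> y by (auto simp: bij_betw_def)
      then show ?thesis using row[of z] \<kappa>[of z] by (simp add: krylov_matrix_def)
    qed
    then have "C \<subseteq> {y. h \<bullet> y = 0}" by (auto simp: inner_commute)
    then have "span C \<subseteq> {y. h \<bullet> y = 0}"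
      by (rule span_minimal) (rule subspace_hyperplane)
    then have "h \<bullet> h = 0" using spanC by blast
    then show ?thesis by simp
  qed
  then have "det (krylov_matrix E B w x \<kappa>) \<noteq> 0"
    by (simp add: invertible_det_nz[symmetric] invertible_left_inverse matrix_left_invertible_ker)
  then show ?thesis by (rule that)
qed

section \<open>Passage to generic weights\<close>

text \<open>The tree weights fix \<kappa> and show that the determinant is not identically zero.
  They may lie outside the positive weights, which is harmless as the determinant is a polynomial on
  the whole space.\<close>

lemma generic_krylov_matrix:
  fixes E :: "'v::finite set set"
  assumes con: "connected_graph E" and x: "x \<in> B"
  obtains \<kappa> where "{w \<in> space (\<Pi>\<^sub>M e\<in>E. lborel). det (krylov_matrix E B w x \<kappa>) = 0}
    \<in> null_sets (\<Pi>\<^sub>M e\<in>E. lborel)"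
proof -
  obtain w where w: "\<And>e. 0 \<le> w e" "\<And>e. w e \<noteq> 0 \<Longrightarrow> e \<in> E"
    "\<And>y. (x, y) \<in> {(a, b). 0 < w {a, b}}\<^sup>*" "root_detecting B w UNIV x"
    using joined_root_detecting[OF connected_graph_joined[OF con, of x], of B] by auto
  have "{(a, b). 0 < w {a, b}} = {(a, b). {a, b} \<in> E \<and> 0 < w {a, b}}"
    using w(2) by force
  then have det: "det (dirichlet_matrix E B w) \<noteq> 0"
    using w(1,3) x by (intro det_dirichlet_matrix_nonzero) auto
  obtain \<kappa> where "det (krylov_matrix E B w x \<kappa>) \<noteq> 0"
    using krylov_matrix_exists[OF det x] root_detecting_scaled_steklov[OF det w(4) x w(2)] by metis
  then show ?thesis
    using poly_on_zeros_null[OF finite poly_on_det_krylov_matrix] that by blast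
qed

lemma det_dirichlet_matrix_positive_weights:
  assumes "connected_graph E" "B \<noteq> {}" "w \<in> positive_weights E"
  shows "det (dirichlet_matrix E B w) \<noteq> 0"
proof -
  obtain b where b: "b \<in> B" using assms by auto
  have pos: "0 < w e" if "e \<in> E" for e
    using assms(3) that by (auto simp: positive_weights_def dest: PiE_mem)
  then have "{(a, b). {a, b} \<in> E \<and> 0 < w {a, b}} = {(a, b). {a, b} \<in> E}" by auto
  then show ?thesis
    using assms(1) b pos
    by (intro det_dirichlet_matrix_nonzero[of _ _ b]) (auto simp: connected_graph_def less_imp_le)
qed

lemma generic_weights_mono:
  assumes "generic_weights E P" "\<And>w. w \<in> positive_weights E \<Longrightarrow> P w \<Longrightarrow> Q w"
  shows "generic_weights E Q"
proof -
  have "{w \<in> positive_weights E. \<not> Q w} \<subseteq> {w \<in> positive_weights E. \<not> P w}"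
    using assms(2) by blast
  then show ?thesis
    using assms(1) unfolding generic_weights_def by (rule null_sets_completion_subset)
qed

lemma generic_eigenfunctions_nonvanishing:
  fixes E :: "'v::finite set set"
  assumes con: "connected_graph E" and ne: "B \<noteq> {}"
  shows "generic_weights E (\<lambda>w. \<forall>f. steklov_eigenfunction E B w f \<longrightarrow> (\<forall>x\<in>B. f $ x \<noteq> 0))"
proof -
  define Z where
    "Z x \<kappa> = {w \<in> space (\<Pi>\<^sub>M e\<in>E. lborel). det (krylov_matrix E B w x \<kappa>) = 0}" for x \<kappa>
  have "\<forall>x\<in>B. \<exists>\<kappa>. Z x \<kappa> \<in> null_sets (\<Pi>\<^sub>M e\<in>E. lborel)"
    unfolding Z_def by (auto elim: generic_krylov_matrix[OF con])
  then obtain \<kappa> where \<kappa>: "\<And>x. x \<in> B \<Longrightarrow> Z x (\<kappa> x) \<in> null_sets (\<Pi>\<^sub>M e\<in>E. lborel)"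
    by metis
  define N where "N = (\<Union>x\<in>B. Z x (\<kappa> x))"
  have "N \<in> null_sets (\<Pi>\<^sub>M e\<in>E. lborel)"
    unfolding N_def using \<kappa> by (intro null_sets_UN') (auto intro: countable_finite)
  moreover have "{w \<in> positive_weights E.
      \<not> (\<forall>f. steklov_eigenfunction E B w f \<longrightarrow> (\<forall>x\<in>B. f $ x \<noteq> 0))} \<subseteq> N"
  proof
    fix w
    assume "w \<in> {w \<in> positive_weights E.
      \<not> (\<forall>f. steklov_eigenfunction E B w f \<longrightarrow> (\<forall>x\<in>B. f $ x \<noteq> 0))}"
    then obtain f x where w: "w \<in> positive_weights E" and f: "steklov_eigenfunction E B w f"
      and x: "x \<in> B" "f $ x = 0"
      by blast
    have det: "det (dirichlet_matrix E B w) \<noteq> 0"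
      using con ne w by (rule det_dirichlet_matrix_positive_weights)
    obtain \<mu> where \<mu>: "f \<in> boundary_space B" "steklov_operator E B w f = \<mu> *\<^sub>R f" "f \<noteq> 0"
      using f by (auto simp: steklov_eigenfunction_def steklov_eigenspace_def)
    \<comment> \<open>Clearing the denominator keeps the eigenfunction and rescales its
      eigenvalue.\<close>
    then have "scaled_steklov E B w f = (det (dirichlet_matrix E B w) * \<mu>) *\<^sub>R f"
      using det by (simp add: scaled_steklov_eq)
    then have "det (krylov_matrix E B w x (\<kappa> x)) = 0"
      using krylov_matrix_detects[OF det _ x(1) \<mu>(1) _ x(2)] \<mu>(3) by blast
    moreover have "w \<in> space (\<Pi>\<^sub>M e\<in>E. lborel)"
      using w by (auto simp: positive_weights_def space_PiM)
    ultimately show "w \<in> N"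
      using x by (auto simp: N_def Z_def)
  qed
  \<comment> \<open>The exceptional set is only shown to lie inside a Borel null set; completeness
    makes it null itself.\<close>
  ultimately show ?thesis
    unfolding generic_weights_def
    by (blast intro: null_sets_completion_subset null_sets_completionI)
qed

text \<open>Subtracting from \<open>g\<close> the multiple of \<open>f\<close> with the same value
  at \<open>x\<close> leaves an element of the eigenspace vanishing at \<open>x\<close>, which must
  be zero.\<close>

lemma simple_if_nonvanishing:
  fixes E :: "'v::finite set set"
  assumes det: "det (dirichlet_matrix E B w) \<noteq> 0" and x: "x \<in> B"
    and nonvan: "\<And>f. steklov_eigenfunction E B w f \<Longrightarrow> f $ x \<noteq> 0"
    and ev: "steklov_eigenvalue E B w \<mu>"
  shows "dim (steklov_eigenspace E B w \<mu>) = 1"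
proof -
  let ?d = "det (dirichlet_matrix E B w)" and ?S = "steklov_eigenspace E B w \<mu>"
  have lin: "linear (scaled_steklov E B w)"
    using det by (rule linear_scaled_steklov)
  \<comment> \<open>\<open>scaled_steklov\<close> is linear on the whole space, so in this form the
    eigenspace is readily seen to be a subspace.\<close>
  have S: "?S = {f \<in> boundary_space B. scaled_steklov E B w f = (?d * \<mu>) *\<^sub>R f}"
    unfolding steklov_eigenspace_def using det
    by (auto simp: scaled_steklov_eq simp flip: scaleR_scaleR)
  have sub: "subspace ?S"
    using subspace_boundary_space[of B] lin unfolding S
    by (auto simp: subspace_def linear_0 linear_add linear_scale algebra_simps)
  obtain f where f: "f \<in> ?S" "f \<noteq> 0"
    using ev by (auto simp: steklov_eigenvalue_def)
  then have fx: "f $ x \<noteq> 0"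
    using nonvan by (auto simp: steklov_eigenfunction_def)
  have "g \<in> span {f}" if g: "g \<in> ?S" for g
  proof -
    define u where "u = g - (g $ x / f $ x) *\<^sub>R f"
    have "u \<in> ?S"
      unfolding u_def using sub f(1) g by (intro subspace_diff subspace_scale)
    moreover have "u $ x = 0" using fx by (simp add: u_def)
    ultimately have "u = 0"
      using nonvan by (auto simp: steklov_eigenfunction_def)
    then have "g = (g $ x / f $ x) *\<^sub>R f" by (simp add: u_def)
    then show ?thesis by (metis span_base span_scale singletonI)
  qed
  then have "?S = span {f}"
    using f(1) sub by (intro equalityI subsetI) (auto intro: span_minimal[THEN subsetD])
  then show ?thesis
    using f(2) by (simp)
qed

theorem theorem1p1:
  fixes E :: "'v::finite set set" and B :: "'v set"
  assumes "simple_graph E" and "connected_graph E" and "B \<noteq> {}"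
  shows "generic_weights E
           (\<lambda>w. \<forall>\<mu>. steklov_eigenvalue E B w \<mu> \<longrightarrow> dim (steklov_eigenspace E B w \<mu>) = 1)
         \<and> generic_weights E
           (\<lambda>w. \<forall>f. steklov_eigenfunction E B w f \<longrightarrow> (\<forall>x\<in>B. f $ x \<noteq> 0))"
proof
  show nonvan: "generic_weights E
      (\<lambda>w. \<forall>f. steklov_eigenfunction E B w f \<longrightarrow> (\<forall>x\<in>B. f $ x \<noteq> 0))"
    using assms(2,3) by (rule generic_eigenfunctions_nonvanishing)
  obtain b where b: "b \<in> B" using assms(3) by auto
  show "generic_weights E
      (\<lambda>w. \<forall>\<mu>. steklov_eigenvalue E B w \<mu> \<longrightarrow> dim (steklov_eigenspace E B w \<mu>) = 1)"
    using nonvan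
  proof (rule generic_weights_mono, intro allI impI)
    fix w \<mu>
    assume w: "w \<in> positive_weights E" "steklov_eigenvalue E B w \<mu>"
      and "\<forall>f. steklov_eigenfunction E B w f \<longrightarrow> (\<forall>x\<in>B. f $ x \<noteq> 0)"
    then show "dim (steklov_eigenspace E B w \<mu>) = 1"
      using det_dirichlet_matrix_positive_weights[OF assms(2,3) w(1)] b
      by (intro simple_if_nonvanishing[of E B w b]) auto
  qed
qed

end
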